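(* Let $D$ be a commutative ring and let $A$ be a $D$-algebra with unit $1$. Every $A\star$-linear mapping $f:A\to A$ has the form $$f(c)=cd\quad(c\in A)$$ for some $d\in A$. Moreover, let $e_0=1,e_1,\dots,e_n$ be a basis of $A$ over its scalar algebra $\operatorname{Re}A$, with structural constants $C^p_{kl}\in\operatorname{Re}A$, $e_ke_l=\sum_p C^p_{kl}e_p$. Let $f^i_l\in \operatorname{Re}A$ be the coordinates of $f$ relative to this basis, so that $f(c)=\sum_{i,l}c^l f^i_l\,e_i$ for $c=\sum_l c^l e_l$. Then for all $j,k$ $$f^j_k=\sum_i f^i_0\,C^j_{ki},\qquad\text{and}\qquad d=\sum_i f^i_0\,e_i .$$
   Context: A $D$-algebra is a $D$-module $A$ equipped with a $D$-bilinear product, not assumed associative or commutative. A mapping $f:A\to A$ is $A\star$-linear if it is additive and $f(ac)=a\,f(c)$ for all $a,c\in A$. The center $Z(A)$ is the set of elements of $A$ that commute with all elements of $A$ and whose associators (in every position) with all pairs of elements of $A$ vanish, where the associator is $(a,b,c)=(ab)c-a(bc)$. The ring $D$ is identified with $D\,1\subseteq Z(A)$. The scalar algebra $\operatorname{Re}A$ denotes a fixed subalgebra of $A$ with $D\subseteq\operatorname{Re}A\subseteq Z(A)$ such that $A$ is a free $(\operatorname{Re}A)$-module with a finite basis $e_0,\dots,e_n$ in which $e_0=1$. *)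

theory Defs
  imports "HOL-Algebra.Module"
begin

text \<open>The algebra locale of \<^theory>\<open>HOL-Algebra.Module\<close> requires a commutative ring. Here the product
  is only bilinear, so \<^term>\<open>monoid.mult\<close> and \<^term>\<open>monoid.one\<close> of the module record are used directly.\<close>

locale unital_nonassoc_algebra = module D A
  for D :: "('d, 'r) ring_scheme" and A :: "('d, 'a, 'm) module_scheme" (structure) +
  assumes mult_closed: "\<lbrakk> a \<in> carrier A; b \<in> carrier A \<rbrakk> \<Longrightarrow> a \<otimes> b \<in> carrier A"
    and mult_add_left: "\<lbrakk> a \<in> carrier A; b \<in> carrier A; c \<in> carrier A \<rbrakk>
      \<Longrightarrow> (a \<oplus> b) \<otimes> c = (a \<otimes> c) \<oplus> (b \<otimes> c)"
    and mult_add_right: "\<lbrakk> a \<in> carrier A; b \<in> carrier A; c \<in> carrier A \<rbrakk>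
      \<Longrightarrow> a \<otimes> (b \<oplus> c) = (a \<otimes> b) \<oplus> (a \<otimes> c)"
    and mult_smult_left: "\<lbrakk> t \<in> carrier D; a \<in> carrier A; b \<in> carrier A \<rbrakk>
      \<Longrightarrow> (t \<odot> a) \<otimes> b = t \<odot> (a \<otimes> b)"
    and mult_smult_right: "\<lbrakk> t \<in> carrier D; a \<in> carrier A; b \<in> carrier A \<rbrakk>
      \<Longrightarrow> a \<otimes> (t \<odot> b) = t \<odot> (a \<otimes> b)"
    and unit_closed: "\<one> \<in> carrier A"
    and mult_unit_left: "a \<in> carrier A \<Longrightarrow> \<one> \<otimes> a = a"
    and mult_unit_right: "a \<in> carrier A \<Longrightarrow> a \<otimes> \<one> = a"

definition Astar_linear :: "('d, 'a, 'm) module_scheme \<Rightarrow> ('a \<Rightarrow> 'a) \<Rightarrow> bool" where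
  "Astar_linear A f \<longleftrightarrow> f \<in> carrier A \<rightarrow> carrier A \<and>
     (\<forall>a\<in>carrier A. \<forall>b\<in>carrier A. f (a \<oplus>\<^bsub>A\<^esub> b) = f a \<oplus>\<^bsub>A\<^esub> f b) \<and>
     (\<forall>a\<in>carrier A. \<forall>c\<in>carrier A. f (a \<otimes>\<^bsub>A\<^esub> c) = a \<otimes>\<^bsub>A\<^esub> f c)"

definition associator :: "('d, 'a, 'm) module_scheme \<Rightarrow> 'a \<Rightarrow> 'a \<Rightarrow> 'a \<Rightarrow> 'a" where
  "associator A a b c = ((a \<otimes>\<^bsub>A\<^esub> b) \<otimes>\<^bsub>A\<^esub> c) \<ominus>\<^bsub>A\<^esub> (a \<otimes>\<^bsub>A\<^esub> (b \<otimes>\<^bsub>A\<^esub> c))"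

definition algebra_center :: "('d, 'a, 'm) module_scheme \<Rightarrow> 'a set" where
  "algebra_center A = {z \<in> carrier A.
     (\<forall>a\<in>carrier A. z \<otimes>\<^bsub>A\<^esub> a = a \<otimes>\<^bsub>A\<^esub> z) \<and>
     (\<forall>a\<in>carrier A. \<forall>b\<in>carrier A.
        associator A z a b = \<zero>\<^bsub>A\<^esub> \<and> associator A a z b = \<zero>\<^bsub>A\<^esub> \<and> associator A a b z = \<zero>\<^bsub>A\<^esub>)}"

text \<open>Scalars are themselves elements of \<open>A\<close> and act by the product of \<open>A\<close>; the family \<open>e\<close> is used
  on the indices \<open>0, \<dots>, n\<close>.\<close>

definition lin_comb :: "('d, 'a, 'm) module_scheme \<Rightarrow> nat \<Rightarrow> (nat \<Rightarrow> 'a) \<Rightarrow> (nat \<Rightarrow> 'a) \<Rightarrow> 'a" where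
  "lin_comb A n e c = (\<Oplus>\<^bsub>A\<^esub>i\<in>{..n}. c i \<otimes>\<^bsub>A\<^esub> e i)"

definition is_basis :: "('d, 'a, 'm) module_scheme \<Rightarrow> 'a set \<Rightarrow> nat \<Rightarrow> (nat \<Rightarrow> 'a) \<Rightarrow> bool" where
  "is_basis A S n e \<longleftrightarrow> e \<in> {..n} \<rightarrow> carrier A \<and>
     (\<forall>a\<in>carrier A. \<exists>c\<in>{..n} \<rightarrow> S. a = lin_comb A n e c) \<and>
     (\<forall>c\<in>{..n} \<rightarrow> S. lin_comb A n e c = \<zero>\<^bsub>A\<^esub> \<longrightarrow> (\<forall>i\<le>n. c i = \<zero>\<^bsub>A\<^esub>))"

text \<open>The inclusion of \<open>D\<close> in \<open>S\<close> is understood through the map sending \<open>t\<close> to \<open>t\<cdot>1\<close>, which is not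
  required to be injective.\<close>

definition scalar_algebra ::
    "('d, 'r) ring_scheme \<Rightarrow> ('d, 'a, 'm) module_scheme \<Rightarrow> 'a set \<Rightarrow> bool" where
  "scalar_algebra D A S \<longleftrightarrow>
     submodule S D A \<and> (\<forall>a\<in>S. \<forall>b\<in>S. a \<otimes>\<^bsub>A\<^esub> b \<in> S) \<and>
     (\<lambda>t. t \<odot>\<^bsub>A\<^esub> \<one>\<^bsub>A\<^esub>) ` carrier D \<subseteq> S \<and> S \<subseteq> algebra_center A \<and>
     (\<exists>n e. is_basis A S n e \<and> e 0 = \<one>\<^bsub>A\<^esub>)"

text \<open>\<open>C p k l\<close> is the constant with upper index \<open>p\<close> and lower indices \<open>k\<close>, \<open>l\<close>; \<open>F i l\<close> is the
  coordinate of the map with upper index \<open>i\<close> and lower index \<open>l\<close>.\<close>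

definition structural_constants :: "('d, 'a, 'm) module_scheme \<Rightarrow> 'a set \<Rightarrow> nat \<Rightarrow> (nat \<Rightarrow> 'a) \<Rightarrow>
    (nat \<Rightarrow> nat \<Rightarrow> nat \<Rightarrow> 'a) \<Rightarrow> bool" where
  "structural_constants A S n e C \<longleftrightarrow>
     (\<forall>p\<le>n. \<forall>k\<le>n. \<forall>l\<le>n. C p k l \<in> S) \<and>
     (\<forall>k\<le>n. \<forall>l\<le>n. e k \<otimes>\<^bsub>A\<^esub> e l = lin_comb A n e (\<lambda>p. C p k l))"

definition map_coordinates :: "('d, 'a, 'm) module_scheme \<Rightarrow> 'a set \<Rightarrow> nat \<Rightarrow> (nat \<Rightarrow> 'a) \<Rightarrow>
    ('a \<Rightarrow> 'a) \<Rightarrow> (nat \<Rightarrow> nat \<Rightarrow> 'a) \<Rightarrow> bool" where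
  "map_coordinates A S n e f F \<longleftrightarrow>
     (\<forall>i\<le>n. \<forall>l\<le>n. F i l \<in> S) \<and>
     (\<forall>c\<in>{..n} \<rightarrow> S.
        f (lin_comb A n e c) = (\<Oplus>\<^bsub>A\<^esub>i\<in>{..n}. \<Oplus>\<^bsub>A\<^esub>l\<in>{..n}. (c l \<otimes>\<^bsub>A\<^esub> F i l) \<otimes>\<^bsub>A\<^esub> e i))"

end

theory Submission
  imports Defs
begin

text \<open>Linearity gives \<open>f c = f (c \<cdot> 1) = c \<cdot> f 1\<close>, so \<open>d = f 1\<close>. Column \<open>k\<close> of the coordinates of \<open>f\<close>
  consists of the coordinates of \<open>f (e k) = e k \<cdot> d\<close>; since scalars lie in the center, they can be moved
  to the front when this product is expanded, and comparing coefficients gives the formula.\<close>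

section \<open>Double sums and differences in abelian monoids and groups\<close>

lemma (in abelian_monoid) finsum_swap:
  assumes "finite I" "finite J" "\<And>i j. i \<in> I \<Longrightarrow> j \<in> J \<Longrightarrow> g i j \<in> carrier G"
  shows "(\<Oplus>i\<in>I. \<Oplus>j\<in>J. g i j) = (\<Oplus>j\<in>J. \<Oplus>i\<in>I. g i j)"
  using assms(1,3)
proof (induction I rule: finite_induct)
  case empty
  then show ?case by simp
next
  case (insert x I)
  \<comment> \<open>Row \<open>x\<close> is split off, the remaining rows are swapped by induction,
    and the two sums over \<open>J\<close> are merged termwise.\<close>
  have "(\<Oplus>i\<in>insert x I. \<Oplus>j\<in>J. g i j) = (\<Oplus>j\<in>J. g x j) \<oplus> (\<Oplus>i\<in>I. \<Oplus>j\<in>J. g i j)"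
    using insert by (intro finsum_insert) (auto intro!: finsum_closed)
  also have "\<dots> = (\<Oplus>j\<in>J. g x j) \<oplus> (\<Oplus>j\<in>J. \<Oplus>i\<in>I. g i j)"
    using insert by simp
  also have "\<dots> = (\<Oplus>j\<in>J. g x j \<oplus> (\<Oplus>i\<in>I. g i j))"
    using insert by (intro finsum_addf [symmetric]) (auto intro!: finsum_closed)
  also have "\<dots> = (\<Oplus>j\<in>J. \<Oplus>i\<in>insert x I. g i j)"
    using insert by (intro finsum_cong' refl finsum_insert [symmetric]) (auto intro!: finsum_closed)
  finally show ?case .
qed

text \<open>Serves twice: to read a vanishing associator as equality of two bracketings, and a
  vanishing difference of coefficients as equality of coordinates.\<close>

lemma (in abelian_group) add_uminus_eq_zero_iff:
  "\<lbrakk> a \<in> carrier G; b \<in> carrier G \<rbrakk> \<Longrightarrow> a \<oplus> \<ominus> b = \<zero> \<longleftrightarrow> a = b"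
  by (metis a_inv_closed minus_equality minus_minus r_neg)

section \<open>The bilinear product and central elements\<close>

context unital_nonassoc_algebra
begin

lemma mult_zero_right: "a \<in> carrier A \<Longrightarrow> a \<otimes> \<zero> = \<zero>"
  using mult_add_right [of a \<zero> \<zero>] mult_closed [of a \<zero>]
  by (metis M.add.l_cancel_one M.l_zero M.zero_closed)

lemma mult_zero_left: "a \<in> carrier A \<Longrightarrow> \<zero> \<otimes> a = \<zero>"
  using mult_add_left [of \<zero> \<zero> a] mult_closed [of \<zero> a]
  by (metis M.add.l_cancel_one M.l_zero M.zero_closed)

lemma mult_minus_left:
  assumes "a \<in> carrier A" "b \<in> carrier A"
  shows "(\<ominus> a) \<otimes> b = \<ominus> (a \<otimes> b)"
  using mult_add_left [of "\<ominus> a" a b] mult_zero_left [of b] assms mult_closed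
  by (intro M.minus_equality [symmetric]) (simp_all add: M.l_neg)

lemma mult_finsum_right:
  assumes "finite I" "a \<in> carrier A" "\<And>i. i \<in> I \<Longrightarrow> g i \<in> carrier A"
  shows "a \<otimes> (\<Oplus>i\<in>I. g i) = (\<Oplus>i\<in>I. a \<otimes> g i)"
  using assms(1,3)
  by (induction I rule: finite_induct)
    (simp_all add: assms(2) mult_zero_right mult_add_right mult_closed Pi_I M.finsum_closed)

lemma mult_finsum_left:
  assumes "finite I" "a \<in> carrier A" "\<And>i. i \<in> I \<Longrightarrow> g i \<in> carrier A"
  shows "(\<Oplus>i\<in>I. g i) \<otimes> a = (\<Oplus>i\<in>I. g i \<otimes> a)"
  using assms(1,3)
  by (induction I rule: finite_induct)
    (simp_all add: assms(2) mult_zero_left mult_add_left mult_closed Pi_I M.finsum_closed)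

lemma center_commute:
  "\<lbrakk> z \<in> algebra_center A; a \<in> carrier A \<rbrakk> \<Longrightarrow> z \<otimes> a = a \<otimes> z"
  unfolding algebra_center_def by blast

lemma center_assoc:
  assumes "z \<in> algebra_center A" "a \<in> carrier A" "b \<in> carrier A"
  shows "(z \<otimes> a) \<otimes> b = z \<otimes> (a \<otimes> b)" and "(a \<otimes> z) \<otimes> b = a \<otimes> (z \<otimes> b)"
  using assms unfolding algebra_center_def associator_def
  by (auto simp: mult_closed a_minus_def M.add_uminus_eq_zero_iff)

text \<open>\<open>a (z b) = (a z) b = (z a) b = z (a b)\<close>: the associators with
  \<open>z\<close> in second and in first position vanish, and \<open>z\<close> commutes with
  \<open>a\<close>.\<close>

lemma center_left_commute:
  assumes "z \<in> algebra_center A" "a \<in> carrier A" "b \<in> carrier A"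
  shows "a \<otimes> (z \<otimes> b) = z \<otimes> (a \<otimes> b)"
  using center_assoc [OF assms] center_commute [OF assms(1,2)] by simp

lemma Astar_linear_eq:
  assumes "Astar_linear A f" "c \<in> carrier A"
  shows "f c = c \<otimes> f \<one>"
  using assms unit_closed mult_unit_right [of c] unfolding Astar_linear_def by metis

end

section \<open>Closure properties of the scalar algebra\<close>

locale scalar_basis = unital_nonassoc_algebra +
  fixes S n e
  assumes scalar: "scalar_algebra D A S" and basis: "is_basis A S n e"
begin

lemma scalar_center: "s \<in> S \<Longrightarrow> s \<in> algebra_center A"
  using scalar unfolding scalar_algebra_def by blast

lemma scalar_carrier: "s \<in> S \<Longrightarrow> s \<in> carrier A"
  using scalar_center unfolding algebra_center_def by blast

lemma scalar_mult: "\<lbrakk> s \<in> S; t \<in> S \<rbrakk> \<Longrightarrow> s \<otimes> t \<in> S"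
  using scalar unfolding scalar_algebra_def by blast

lemma scalar_subgroup: "subgroup S (add_monoid A)"
  using scalar unfolding scalar_algebra_def submodule_def by blast

lemma scalar_zero: "\<zero> \<in> S"
  using subgroup.one_closed [OF scalar_subgroup] by simp

lemma scalar_add: "\<lbrakk> s \<in> S; t \<in> S \<rbrakk> \<Longrightarrow> s \<oplus> t \<in> S"
  using subgroup.m_closed [OF scalar_subgroup] by simp

lemma scalar_uminus: "s \<in> S \<Longrightarrow> \<ominus> s \<in> S"
  using subgroup.m_inv_closed [OF scalar_subgroup] unfolding a_inv_def by simp

lemma scalar_finsum:
  assumes "finite I" "\<And>i. i \<in> I \<Longrightarrow> g i \<in> S"
  shows "(\<Oplus>i\<in>I. g i) \<in> S"
  using assms
  by (induction I rule: finite_induct)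
    (simp_all add: scalar_zero scalar_add scalar_carrier Pi_I)

lemma scalar_one: "\<one> \<in> S"
proof -
  \<comment> \<open>The unit of \<open>A\<close> is the image of the unit of \<open>D\<close>, and
    \<open>S\<close> contains the image of \<open>D\<close>.\<close>
  have "\<one>\<^bsub>D\<^esub> \<odot> \<one> \<in> S"
    using scalar unfolding scalar_algebra_def by blast
  then show ?thesis by (simp add: unit_closed)
qed

section \<open>Uniqueness of coordinates and the coordinates of a map\<close>

lemma basis_carrier: "i \<le> n \<Longrightarrow> e i \<in> carrier A"
  using basis unfolding is_basis_def by auto

lemma basis_expansion:
  assumes "a \<in> carrier A"
  obtains c where "c \<in> {..n} \<rightarrow> S" "a = lin_comb A n e c"
  using basis assms unfolding is_basis_def by blast

text \<open>Linear independence in \<open>is_basis\<close> speaks only of combinations equal to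
  zero, so it is applied to the differences \<open>b j \<oplus> \<ominus> c j\<close>, which again
  lie in \<open>S\<close>.\<close>

lemma lin_comb_unique:
  assumes b: "b \<in> {..n} \<rightarrow> S" and c: "c \<in> {..n} \<rightarrow> S"
    and eq: "lin_comb A n e b = lin_comb A n e c" and i: "i \<le> n"
  shows "b i = c i"
proof -
  have bS: "b j \<in> S" and cS: "c j \<in> S" if "j \<le> n" for j
    using b c that by auto
  have carr: "b j \<otimes> e j \<in> carrier A" "c j \<otimes> e j \<in> carrier A" "(\<ominus> c j) \<otimes> e j \<in> carrier A"
    if "j \<le> n" for j
    using bS cS that by (simp_all add: mult_closed scalar_carrier basis_carrier)
  have diff: "(\<lambda>j. b j \<oplus> \<ominus> c j) \<in> {..n} \<rightarrow> S"
    using bS cS by (simp add: scalar_add scalar_uminus)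
  \<comment> \<open>Adding the combination of \<open>c\<close> back cancels termwise and leaves that
    of \<open>b\<close>. As the two are equal, group cancellation makes the combination of the
    differences zero.\<close>
  have "lin_comb A n e (\<lambda>j. b j \<oplus> \<ominus> c j) \<oplus> lin_comb A n e c =
      (\<Oplus>j\<in>{..n}. (b j \<oplus> \<ominus> c j) \<otimes> e j \<oplus> c j \<otimes> e j)"
    unfolding lin_comb_def using bS cS
    by (intro M.finsum_addf [symmetric])
      (auto simp: mult_closed scalar_carrier basis_carrier scalar_add scalar_uminus)
  also have "\<dots> = lin_comb A n e b"
    unfolding lin_comb_def
  proof (rule M.finsum_cong')
    fix j assume "j \<in> {..n}"
    then have j: "j \<le> n" by simp
    have "(b j \<oplus> \<ominus> c j) \<otimes> e j = b j \<otimes> e j \<oplus> \<ominus> (c j \<otimes> e j)"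
      using j bS cS by (simp add: mult_add_left mult_minus_left scalar_carrier basis_carrier)
    then show "(b j \<oplus> \<ominus> c j) \<otimes> e j \<oplus> c j \<otimes> e j = b j \<otimes> e j"
      using carr [OF j] by (simp add: M.add.m_assoc M.l_neg)
  qed (use carr in auto)
  finally have "lin_comb A n e (\<lambda>j. b j \<oplus> \<ominus> c j) \<oplus> lin_comb A n e c = lin_comb A n e c"
    using eq by simp
  moreover have "lin_comb A n e (\<lambda>j. b j \<oplus> \<ominus> c j) \<in> carrier A" "lin_comb A n e c \<in> carrier A"
    unfolding lin_comb_def using diff carr
    by (auto simp: Pi_iff intro!: M.finsum_closed mult_closed
      intro: scalar_carrier basis_carrier)
  ultimately have "lin_comb A n e (\<lambda>j. b j \<oplus> \<ominus> c j) = \<zero>"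
    by simp
  then have "b i \<oplus> \<ominus> c i = \<zero>"
    using basis diff i unfolding is_basis_def by blast
  then show ?thesis
    using bS [OF i] cS [OF i] scalar_carrier M.add_uminus_eq_zero_iff by simp
qed

lemma lin_comb_unit_vector:
  assumes "k \<le> n"
  shows "lin_comb A n e (\<lambda>l. if l = k then \<one> else \<zero>) = e k"
proof -
  \<comment> \<open>The equation is turned to \<open>k = l\<close>, the shape that
    \<open>finsum_singleton\<close> expects.\<close>
  have "lin_comb A n e (\<lambda>l. if l = k then \<one> else \<zero>) = (\<Oplus>l\<in>{..n}. if k = l then e l else \<zero>)"
    unfolding lin_comb_def
    by (intro M.finsum_cong') (auto simp: mult_unit_left mult_zero_left basis_carrier)
  also have "\<dots> = e k"
    using assms basis_carrier by (intro M.finsum_singleton) auto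
  finally show ?thesis .
qed

text \<open>It suffices to test on basis vectors: column \<open>l\<close> of \<open>F\<close> must
  hold the coordinates of \<open>f (e l)\<close>. One direction evaluates at unit coefficient
  families, the other uses that \<open>f\<close> respects scalar combinations.\<close>

lemma map_coordinates_iff:
  assumes f: "Astar_linear A f"
  shows "map_coordinates A S n e f F \<longleftrightarrow>
    (\<forall>i\<le>n. \<forall>l\<le>n. F i l \<in> S) \<and> (\<forall>l\<le>n. f (e l) = lin_comb A n e (\<lambda>i. F i l))"
\<comment> \<open>If some entry lies outside \<open>S\<close>, both sides are false.\<close>
proof (cases "\<forall>i\<le>n. \<forall>l\<le>n. F i l \<in> S")
  case FS: True
  \<comment> \<open>Swapping the sums and rebracketing with the central \<open>c l\<close> gathers
    the double sum by columns of \<open>F\<close>.\<close>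
  have expand: "(\<Oplus>i\<in>{..n}. \<Oplus>l\<in>{..n}. (c l \<otimes> F i l) \<otimes> e i) =
      (\<Oplus>l\<in>{..n}. c l \<otimes> lin_comb A n e (\<lambda>i. F i l))" if c: "c \<in> {..n} \<rightarrow> S" for c
  proof -
    have "(\<Oplus>i\<in>{..n}. \<Oplus>l\<in>{..n}. (c l \<otimes> F i l) \<otimes> e i) =
        (\<Oplus>l\<in>{..n}. \<Oplus>i\<in>{..n}. (c l \<otimes> F i l) \<otimes> e i)"
      using c FS by (intro M.finsum_swap) (auto intro!: mult_closed intro: scalar_carrier basis_carrier)
    also have "\<dots> = (\<Oplus>l\<in>{..n}. c l \<otimes> lin_comb A n e (\<lambda>i. F i l))"
    proof (rule M.finsum_cong')
      fix l assume l: "l \<in> {..n}"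
      then have cl: "c l \<in> S" using c by auto
      have "(\<Oplus>i\<in>{..n}. (c l \<otimes> F i l) \<otimes> e i) = (\<Oplus>i\<in>{..n}. c l \<otimes> (F i l \<otimes> e i))"
        using l cl FS
        by (intro M.finsum_cong')
          (auto intro!: mult_closed center_assoc(1) intro: scalar_center scalar_carrier basis_carrier)
      also have "\<dots> = c l \<otimes> lin_comb A n e (\<lambda>i. F i l)"
        unfolding lin_comb_def using l cl FS
        by (intro mult_finsum_right [symmetric])
          (auto intro!: mult_closed intro: scalar_carrier basis_carrier)
      finally show "(\<Oplus>i\<in>{..n}. (c l \<otimes> F i l) \<otimes> e i) = c l \<otimes> lin_comb A n e (\<lambda>i. F i l)" .
    qed (use c FS in \<open>auto simp: lin_comb_def Pi_iff
        intro!: mult_closed M.finsum_closed intro: scalar_carrier basis_carrier\<close>)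
    finally show ?thesis .
  qed
  have f1: "f \<one> \<in> carrier A"
    using f unit_closed unfolding Astar_linear_def by blast
  \<comment> \<open>Writing \<open>f\<close> as right multiplication by \<open>f \<one>\<close>
    reduces this to distributivity over a finite sum; centrality of \<open>c l\<close> then gives
    \<open>(c l \<otimes> e l) \<otimes> f \<one> = c l \<otimes> f (e l)\<close>.\<close>
  have f_lin: "f (lin_comb A n e c) = (\<Oplus>l\<in>{..n}. c l \<otimes> f (e l))" if c: "c \<in> {..n} \<rightarrow> S" for c
  proof -
    have carr: "c l \<otimes> e l \<in> carrier A" if "l \<le> n" for l
      using c that by (auto intro!: mult_closed intro: scalar_carrier basis_carrier)
    then have "f (lin_comb A n e c) = lin_comb A n e c \<otimes> f \<one>"
      unfolding lin_comb_def by (intro Astar_linear_eq [OF f] M.finsum_closed) auto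
    also have "\<dots> = (\<Oplus>l\<in>{..n}. (c l \<otimes> e l) \<otimes> f \<one>)"
      unfolding lin_comb_def using f1 carr by (intro mult_finsum_left) auto
    also have "\<dots> = (\<Oplus>l\<in>{..n}. c l \<otimes> f (e l))"
      using c f1
      by (intro M.finsum_cong')
        (auto simp: Astar_linear_eq [OF f basis_carrier] Pi_iff
          intro!: mult_closed center_assoc(1) intro: scalar_center scalar_carrier basis_carrier)
    finally show ?thesis .
  qed
  have "f (e l) = lin_comb A n e (\<lambda>i. F i l)"
    if m: "map_coordinates A S n e f F" and l: "l \<le> n" for l
  proof -
    \<comment> \<open>The unit family at \<open>l\<close>, admissible because \<open>S\<close>
      contains zero and one; it selects column \<open>l\<close>.\<close>
    let ?u = "\<lambda>m. if m = l then \<one> else \<zero>"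
    have u: "?u \<in> {..n} \<rightarrow> S"
      using scalar_one scalar_zero by auto
    have "f (e l) = (\<Oplus>m\<in>{..n}. ?u m \<otimes> lin_comb A n e (\<lambda>i. F i m))"
      using m expand [OF u] lin_comb_unit_vector [OF l] u unfolding map_coordinates_def by auto
    also have "\<dots> = (\<Oplus>m\<in>{..n}. if l = m then lin_comb A n e (\<lambda>i. F i m) else \<zero>)"
      using FS unfolding lin_comb_def
      by (intro M.finsum_cong')
        (auto simp: mult_unit_left mult_zero_left Pi_iff
          intro!: M.finsum_closed mult_closed mult_unit_left mult_zero_left
          intro: scalar_carrier basis_carrier)
    also have "\<dots> = lin_comb A n e (\<lambda>i. F i l)"
      using l FS unfolding lin_comb_def
      by (intro M.finsum_singleton)
        (auto intro!: M.finsum_closed mult_closed intro: scalar_carrier basis_carrier)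
    finally show ?thesis .
  qed
  moreover have "f (lin_comb A n e c) = (\<Oplus>i\<in>{..n}. \<Oplus>l\<in>{..n}. (c l \<otimes> F i l) \<otimes> e i)"
    if "\<forall>l\<le>n. f (e l) = lin_comb A n e (\<lambda>i. F i l)" "c \<in> {..n} \<rightarrow> S" for c
    unfolding expand [OF that(2)] f_lin [OF that(2)] using that FS
    by (intro M.finsum_cong') (auto simp: lin_comb_def Pi_iff
        intro!: mult_closed M.finsum_closed intro: scalar_carrier basis_carrier)
  ultimately show ?thesis
    using FS unfolding map_coordinates_def by blast
qed (auto simp: map_coordinates_def)

lemma map_coordinates_exist:
  assumes f: "Astar_linear A f"
  shows "\<exists>F. map_coordinates A S n e f F"
proof -
  \<comment> \<open>The bound on \<open>l\<close> stands under the existential so that a total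
    choice function exists; its values beyond \<open>n\<close> are arbitrary.\<close>
  have "\<forall>l. \<exists>c. l \<le> n \<longrightarrow> c \<in> {..n} \<rightarrow> S \<and> f (e l) = lin_comb A n e c"
    using f basis_carrier basis_expansion unfolding Astar_linear_def by (metis PiE)
  then obtain c where "\<And>l. l \<le> n \<Longrightarrow> c l \<in> {..n} \<rightarrow> S \<and> f (e l) = lin_comb A n e (c l)"
    by metis
  \<comment> \<open>The indices are exchanged: the coordinates of \<open>f (e l)\<close> form column
    \<open>l\<close>, and the column is the second index of \<open>F\<close>.\<close>
  then have "map_coordinates A S n e f (\<lambda>i l. c l i)"
    unfolding map_coordinates_iff [OF f] by auto
  then show ?thesis by blast
qed

section \<open>Left multiplication in terms of structural constants\<close>

lemma mult_lin_comb:
  assumes a: "a \<in> carrier A" and g: "g \<in> {..n} \<rightarrow> S"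
  shows "a \<otimes> lin_comb A n e g = (\<Oplus>i\<in>{..n}. g i \<otimes> (a \<otimes> e i))"
proof -
  have "a \<otimes> lin_comb A n e g = (\<Oplus>i\<in>{..n}. a \<otimes> (g i \<otimes> e i))"
    unfolding lin_comb_def using a g
    by (intro mult_finsum_right) (auto intro!: mult_closed intro: scalar_carrier basis_carrier)
  also have "\<dots> = (\<Oplus>i\<in>{..n}. g i \<otimes> (a \<otimes> e i))"
    using a g
    by (intro M.finsum_cong')
      (auto simp: Pi_iff intro!: mult_closed center_left_commute
        intro: scalar_center scalar_carrier basis_carrier)
  finally show ?thesis .
qed

text \<open>Scalars move in front of \<open>e k\<close>, each \<open>e k \<otimes> e i\<close> is
  expanded by \<open>C\<close>, and exchanging the sums collects the coefficient of
  \<open>e p\<close>.\<close>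

lemma basis_mult_lin_comb:
  assumes C: "structural_constants A S n e C" and g: "g \<in> {..n} \<rightarrow> S" and k: "k \<le> n"
  shows "e k \<otimes> lin_comb A n e g = lin_comb A n e (\<lambda>p. \<Oplus>i\<in>{..n}. g i \<otimes> C p k i)"
proof -
  have gS: "g i \<in> S" if "i \<le> n" for i using g that by auto
  have CS: "C p k i \<in> S" if "p \<le> n" "i \<le> n" for p i
    using C k that unfolding structural_constants_def by blast
  have "e k \<otimes> lin_comb A n e g = (\<Oplus>i\<in>{..n}. g i \<otimes> (e k \<otimes> e i))"
    using k g by (intro mult_lin_comb) (auto intro: basis_carrier)
  also have "\<dots> = (\<Oplus>i\<in>{..n}. \<Oplus>p\<in>{..n}. (g i \<otimes> C p k i) \<otimes> e p)"
  proof (rule M.finsum_cong')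
    fix i assume "i \<in> {..n}"
    then have i: "i \<le> n" by simp
    have "g i \<otimes> (e k \<otimes> e i) = g i \<otimes> (\<Oplus>p\<in>{..n}. C p k i \<otimes> e p)"
      using C k i unfolding structural_constants_def lin_comb_def by simp
    also have "\<dots> = (\<Oplus>p\<in>{..n}. g i \<otimes> (C p k i \<otimes> e p))"
      using gS CS i
      by (intro mult_finsum_right) (auto intro!: mult_closed intro: scalar_carrier basis_carrier)
    \<comment> \<open>The product of the two scalars becomes a single coefficient, by centrality of
      \<open>g i\<close>.\<close>
    also have "\<dots> = (\<Oplus>p\<in>{..n}. (g i \<otimes> C p k i) \<otimes> e p)"
      using gS CS i
      by (intro M.finsum_cong')
        (auto intro!: mult_closed center_assoc(1) [symmetric]
          intro: scalar_center scalar_carrier basis_carrier)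
    finally show "g i \<otimes> (e k \<otimes> e i) = (\<Oplus>p\<in>{..n}. (g i \<otimes> C p k i) \<otimes> e p)" .
  qed (use gS CS in \<open>auto intro!: mult_closed M.finsum_closed intro: scalar_carrier basis_carrier\<close>)
  also have "\<dots> = (\<Oplus>p\<in>{..n}. \<Oplus>i\<in>{..n}. (g i \<otimes> C p k i) \<otimes> e p)"
    using gS CS
    by (intro M.finsum_swap) (auto intro!: mult_closed intro: scalar_carrier basis_carrier)
  also have "\<dots> = lin_comb A n e (\<lambda>p. \<Oplus>i\<in>{..n}. g i \<otimes> C p k i)"
    unfolding lin_comb_def using gS CS
    by (intro M.finsum_cong' mult_finsum_left [symmetric])
      (auto intro!: mult_closed M.finsum_closed intro: scalar_carrier basis_carrier)
  finally show ?thesis .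
qed

text \<open>Because \<open>e 0 = \<one>\<close>, column \<open>0\<close> holds the coordinates of
  \<open>f \<one>\<close>. Column \<open>k\<close> then comes from expanding
  \<open>e k \<otimes> f \<one>\<close>.\<close>

lemma map_coordinates_eq:
  assumes f: "Astar_linear A f" and e0: "e 0 = \<one>" and C: "structural_constants A S n e C"
    and F: "map_coordinates A S n e f F"
  shows "f \<one> = lin_comb A n e (\<lambda>i. F i 0)"
    and "\<lbrakk> j \<le> n; k \<le> n \<rbrakk> \<Longrightarrow> F j k = (\<Oplus>i\<in>{..n}. F i 0 \<otimes> C j k i)"
proof -
  have FS: "F i l \<in> S" if "i \<le> n" "l \<le> n" for i l
    using F that unfolding map_coordinates_def by blast
  have fe: "f (e l) = lin_comb A n e (\<lambda>i. F i l)" if "l \<le> n" for l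
    using F that unfolding map_coordinates_iff [OF f] by blast
  show d: "f \<one> = lin_comb A n e (\<lambda>i. F i 0)"
    using fe [of 0] e0 by simp
  show "F j k = (\<Oplus>i\<in>{..n}. F i 0 \<otimes> C j k i)" if j: "j \<le> n" and k: "k \<le> n"
  proof -
    have "lin_comb A n e (\<lambda>i. F i k) = e k \<otimes> lin_comb A n e (\<lambda>i. F i 0)"
      using fe [OF k] Astar_linear_eq [OF f basis_carrier [OF k]] d by simp
    also have "\<dots> = lin_comb A n e (\<lambda>p. \<Oplus>i\<in>{..n}. F i 0 \<otimes> C p k i)"
      using FS k by (intro basis_mult_lin_comb [OF C]) auto
    \<comment> \<open>Both coefficient families have values in \<open>S\<close>, so uniqueness of
      coordinates applies. Naming \<open>b\<close> fixes which family has \<open>F j k\<close> as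
      its value at \<open>j\<close>.\<close>
    finally show ?thesis
      using FS C j k unfolding structural_constants_def
      by (intro lin_comb_unique [where b = "\<lambda>j. F j k"]) (auto intro!: scalar_finsum scalar_mult)
  qed
qed

end

theorem theorem3p6:
  fixes D :: "('d, 'r) ring_scheme" and A :: "('d, 'a, 'm) module_scheme" (structure)
    and f :: "'a \<Rightarrow> 'a"
  assumes "unital_nonassoc_algebra D A" and "Astar_linear A f"
  shows "\<exists>d\<in>carrier A. (\<forall>c\<in>carrier A. f c = c \<otimes> d) \<and>
    (\<forall>ReA n e C. scalar_algebra D A ReA \<and> is_basis A ReA n e \<and> e 0 = \<one> \<and>
        structural_constants A ReA n e C \<longrightarrow>
      (\<exists>F. map_coordinates A ReA n e f F) \<and>
      (\<forall>F. map_coordinates A ReA n e f F \<longrightarrow>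
        (\<forall>j\<le>n. \<forall>k\<le>n. F j k = (\<Oplus>i\<in>{..n}. F i 0 \<otimes> C j k i)) \<and>
        d = (\<Oplus>i\<in>{..n}. F i 0 \<otimes> e i)))"
proof (intro bexI [of _ "f \<one>"] conjI ballI allI impI; (elim conjE)?)
  \<comment> \<open>The witness \<open>f \<one>\<close> is chosen before any basis, so one
    \<open>d\<close> serves all scalar algebras and bases.\<close>
  interpret unital_nonassoc_algebra D A by fact
  show "f c = c \<otimes> f \<one>" if "c \<in> carrier A" for c
    using Astar_linear_eq [OF assms(2) that] .
  show "f \<one> \<in> carrier A"
    using assms(2) unit_closed unfolding Astar_linear_def by blast
  fix ReA n e C
  assume S: "scalar_algebra D A ReA" "is_basis A ReA n e" and e0: "e 0 = \<one>"
    and C: "structural_constants A ReA n e C"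
  interpret scalar_basis D A ReA n e
    using S by unfold_locales
  \<comment> \<open>Existence keeps the claim about all coordinate families \<open>F\<close> from
    being vacuous.\<close>
  show "\<exists>F. map_coordinates A ReA n e f F"
    using map_coordinates_exist [OF assms(2)] .
  fix F assume "map_coordinates A ReA n e f F"
  note eq = map_coordinates_eq [OF assms(2) e0 C this]
  show "f \<one> = (\<Oplus>i\<in>{..n}. F i 0 \<otimes> e i)"
    using eq(1) unfolding lin_comb_def .
  show "F j k = (\<Oplus>i\<in>{..n}. F i 0 \<otimes> C j k i)" if "j \<le> n" "k \<le> n" for j k
    using eq(2) [OF that] .
qed

end
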